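(* Let $\mathcal{A}$ be a real tensor of order $m$ and dimension $n$ that is a $\mathbf{Z}$-tensor. Then $\mathcal{A}$ is a semi-positive tensor ($\mathbf{E_0}$-tensor) if and only if $\mathcal{A}$ is an $\mathcal{M}$-tensor; and $\mathcal{A}$ is a strictly semi-positive tensor ($\mathbf{E}$-tensor) if and only if $\mathcal{A}$ is a strong $\mathcal{M}$-tensor.
   Context: A real tensor of order $m$ ($m\ge 2$) and dimension $n$ is an array $\mathcal{A}=(a_{i_1\ldots i_m})$ with $a_{i_1\ldots i_m}\in\mathbb{R}$, $i_1,\ldots,i_m\in I_n=\{1,\ldots,n\}$; its diagonal entries are $a_{ii\ldots i}$, $i\in I_n$, and all other entries are off-diagonal. For a vector $\mathbf{x}$, $\mathcal{A}\mathbf{x}^{m-1}$ is the vector defined by $(\mathcal{A}\mathbf{x}^{m-1})_i=\sum_{i_2,\ldots,i_m=1}^n a_{i i_2\ldots i_m}x_{i_2}\cdots x_{i_m}$. Vector inequalities are componentwise. $\mathcal{A}$ is semi-positive ($\mathbf{E_0}$-tensor), respectively strictly semi-positive ($\mathbf{E}$-tensor), if for each $\mathbf{x}\in\mathbb{R}^n$ with $\mathbf{x}\ge\mathbf{0}$, $\mathbf{x}\ne\mathbf{0}$, there is $k\in I_n$ with $x_k>0$ and $(\mathcal{A}\mathbf{x}^{m-1})_k\ge 0$, respectively $(\mathcal{A}\mathbf{x}^{m-1})_k>0$. A complex number $\lambda$ is an eigenvalue of a real tensor $\mathcal{B}$ of order $m$ and dimension $n$ if there is a nonzero $\mathbf{x}\in\mathbb{C}^n$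 with $\mathcal{B}\mathbf{x}^{m-1}=\lambda\mathbf{x}^{[m-1]}$, where $\mathbf{x}^{[m-1]}=(x_1^{m-1},\ldots,x_n^{m-1})^T$; $\rho(\mathcal{B})$ denotes the spectral radius, i.e. the largest modulus of the eigenvalues of $\mathcal{B}$. The identity tensor $\mathcal{I}$ has all diagonal entries $1$ and all off-diagonal entries $0$. A tensor is a $\mathbf{Z}$-tensor if all its off-diagonal entries are nonpositive; equivalently, it can be written as $t\mathcal{I}-\mathcal{B}$ with $t\in\mathbb{R}$ and $\mathcal{B}$ a tensor with nonnegative entries. A $\mathbf{Z}$-tensor $\mathcal{A}=t\mathcal{I}-\mathcal{B}$ (with $\mathcal{B}$ nonnegative) is an $\mathcal{M}$-tensor if $t\ge\rho(\mathcal{B})$, and a strong (nonsingular) $\mathcal{M}$-tensor if $t>\rho(\mathcal{B})$. *)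

theory Defs
  imports "HOL-Analysis.Analysis"
begin

text \<open>
  The index set $\{1, \ldots, n\}$ is a finite type \<open>'n\<close>, so the dimension $n$ is
  \<open>CARD('n)\<close>, which is at least $1$. A real tensor of order \<open>m\<close> is a function on index
  lists; only its values on lists of length \<open>m\<close> are entries, and for $m \ge 1$ no definition
  below depends on the others.
\<close>

type_synonym 'n tensor = "'n list \<Rightarrow> real"

definition diagonal_index :: "nat \<Rightarrow> 'n list \<Rightarrow> bool" where
  "diagonal_index m js \<longleftrightarrow> (\<exists>i. js = replicate m i)"

text \<open>
  The vector $\mathcal{A}\mathbf{x}^{m-1}$, for a real tensor and a vector \<open>x\<close> that is real
  (semi-positivity) or complex (eigenvalues). The list \<open>js\<close> is $(i_2, \ldots, i_m)$.
\<close>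

definition tensor_apply ::
  "nat \<Rightarrow> ('n::finite) tensor \<Rightarrow> 'a::real_field ^ 'n \<Rightarrow> 'a ^ 'n" where
  "tensor_apply m A x =
     (\<chi> i. \<Sum>js | length js = m - 1. of_real (A (i # js)) * (\<Prod>j\<leftarrow>js. x $ j))"

definition semi_positive :: "nat \<Rightarrow> ('n::finite) tensor \<Rightarrow> bool" where
  "semi_positive m A \<longleftrightarrow>
     (\<forall>x :: real ^ 'n. (\<forall>i. x $ i \<ge> 0) \<and> x \<noteq> 0 \<longrightarrow>
        (\<exists>k. x $ k > 0 \<and> tensor_apply m A x $ k \<ge> 0))"

definition strictly_semi_positive :: "nat \<Rightarrow> ('n::finite) tensor \<Rightarrow> bool" where
  "strictly_semi_positive m A \<longleftrightarrow>
     (\<forall>x :: real ^ 'n. (\<forall>i. x $ i \<ge> 0) \<and> x \<noteq> 0 \<longrightarrow>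
        (\<exists>k. x $ k > 0 \<and> tensor_apply m A x $ k > 0))"

definition tensor_eigenvalue :: "nat \<Rightarrow> ('n::finite) tensor \<Rightarrow> complex \<Rightarrow> bool" where
  "tensor_eigenvalue m B \<mu> \<longleftrightarrow>
     (\<exists>x :: complex ^ 'n. x \<noteq> 0 \<and> tensor_apply m B x = (\<chi> i. \<mu> * (x $ i) ^ (m - 1)))"

text \<open>
  The greatest element exists because the set of eigenvalues is nonempty and compact
  (for $m \ge 2$).
\<close>

definition tensor_spectral_radius :: "nat \<Rightarrow> ('n::finite) tensor \<Rightarrow> real" where
  "tensor_spectral_radius m B = (GREATEST r. \<exists>\<mu>. tensor_eigenvalue m B \<mu> \<and> r = cmod \<mu>)"

definition identity_tensor :: "nat \<Rightarrow> 'n tensor" where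
  "identity_tensor m js = (if diagonal_index m js then 1 else 0)"

definition nonneg_tensor :: "nat \<Rightarrow> 'n tensor \<Rightarrow> bool" where
  "nonneg_tensor m B \<longleftrightarrow> (\<forall>js. length js = m \<longrightarrow> B js \<ge> 0)"

definition Z_tensor :: "nat \<Rightarrow> 'n tensor \<Rightarrow> bool" where
  "Z_tensor m A \<longleftrightarrow> (\<forall>js. length js = m \<and> \<not> diagonal_index m js \<longrightarrow> A js \<le> 0)"

definition Z_splitting :: "nat \<Rightarrow> 'n tensor \<Rightarrow> real \<Rightarrow> 'n tensor \<Rightarrow> bool" where
  "Z_splitting m A t B \<longleftrightarrow>
     nonneg_tensor m B \<and> (\<forall>js. length js = m \<longrightarrow> A js = t * identity_tensor m js - B js)"

text \<open>
  The pair $(t, \mathcal{B})$ in $\mathcal{A} = t\mathcal{I} - \mathcal{B}$ is not unique, but the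
  comparison of $t$ with $\rho(\mathcal{B})$ does not depend on it: for nonnegative $\mathcal{B}$
  and $s \ge 0$, $\rho(\mathcal{B} + s\mathcal{I}) = \rho(\mathcal{B}) + s$.
\<close>

definition M_tensor :: "nat \<Rightarrow> ('n::finite) tensor \<Rightarrow> bool" where
  "M_tensor m A \<longleftrightarrow>
     Z_tensor m A \<and> (\<exists>t B. Z_splitting m A t B \<and> t \<ge> tensor_spectral_radius m B)"

definition strong_M_tensor :: "nat \<Rightarrow> ('n::finite) tensor \<Rightarrow> bool" where
  "strong_M_tensor m A \<longleftrightarrow>
     Z_tensor m A \<and> (\<exists>t B. Z_splitting m A t B \<and> t > tensor_spectral_radius m B)"

end

theory Submission
  imports Defs
begin

text \<open>
  Write $k = m - 1$. Everything rests on a weak form of the Perron--Frobenius theorem for a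
  nonnegative tensor $\mathcal{B}$ (\<open>perron_frobenius_nonneg_tensor\<close>): there are
  $\rho \in \mathbb{R}$ and a nonzero $\mathbf{x} \ge \mathbf{0}$ with
  $\mathcal{B}\mathbf{x}^{k} = \rho\,\mathbf{x}^{[k]}$, and $\rho$ bounds every $r$ for which
  some nonzero $\mathbf{y} \ge \mathbf{0}$ satisfies
  $r\,\mathbf{y}^{[k]} \le \mathcal{B}\mathbf{y}^{k}$ (a Collatz--Wielandt principle).
  For the existence of $\mathbf{x}$, Brouwer's theorem on the standard simplex gives, for each
  $\varepsilon > 0$, a positive solution of
  $(\mathcal{B}\mathbf{x}^{k})_i + \varepsilon = \lambda x_i^{k}$; positivity makes $\lambda$ a
  bound for all such $r$, and both facts survive the limit $\varepsilon \to 0$ along a convergent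
  subsequence.

  Taking moduli in $\mathcal{B}\mathbf{z}^{k} = \mu\,\mathbf{z}^{[k]}$ shows
  $|\mu|\,|\mathbf{z}|^{[k]} \le \mathcal{B}|\mathbf{z}|^{k}$, so $|\mu| \le \rho$ and $\rho$ is
  the spectral radius of $\mathcal{B}$.

  Now let $\mathcal{A} = t\mathcal{I} - \mathcal{B}$, so that
  $(\mathcal{A}\mathbf{x}^{k})_i = t x_i^{k} - (\mathcal{B}\mathbf{x}^{k})_i$. If $t < \rho$ (or
  $t \le \rho$), the eigenvector $\mathbf{x}$ violates (strict) semi-positivity. Conversely, a
  vector violating strict semi-positivity satisfies
  $t\,\mathbf{y}^{[k]} \le \mathcal{B}\mathbf{y}^{k}$, whence $t \le \rho$; for a violation of
  semi-positivity the inequality is strict on the support of $\mathbf{y}$, so it persists for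
  some $t' > t$, whence $t < \rho$.
\<close>

section \<open>The polynomial map of a tensor\<close>

lemma tensor_apply_real:
  fixes x :: "real ^ 'n::finite"
  shows "tensor_apply m B x $ i =
    (\<Sum>js | length js = m - 1. B (i # js) * (\<Prod>j\<leftarrow>js. x $ j))"
  by (simp add: tensor_apply_def)

lemma prod_list_map_nonneg:
  fixes f :: "'a \<Rightarrow> real"
  assumes "\<And>j. 0 \<le> f j"
  shows "0 \<le> (\<Prod>j\<leftarrow>js. f j)"
  by (induction js) (use assms in auto)

lemma prod_list_map_mono:
  fixes f g :: "'a \<Rightarrow> real"
  assumes "\<And>j. 0 \<le> f j" "\<And>j. f j \<le> g j"
  shows "(\<Prod>j\<leftarrow>js. f j) \<le> (\<Prod>j\<leftarrow>js. g j)"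
proof (induction js)
  case (Cons j js)
  have "0 \<le> g j"
    using assms order_trans by blast
  then show ?case
    using Cons assms by (auto intro!: mult_mono prod_list_map_nonneg)
qed simp

lemma tensor_apply_mono:
  fixes x y :: "real ^ 'n::finite"
  assumes "m \<ge> 1" "nonneg_tensor m B" "\<And>i. 0 \<le> x $ i" "\<And>i. x $ i \<le> y $ i"
  shows "tensor_apply m B x $ i \<le> tensor_apply m B y $ i"
  unfolding tensor_apply_real using assms
  by (intro sum_mono mult_left_mono prod_list_map_mono) (auto simp: nonneg_tensor_def)

lemma tensor_apply_nonneg:
  fixes x :: "real ^ 'n::finite"
  assumes "m \<ge> 1" "nonneg_tensor m B" "\<And>i. 0 \<le> x $ i"
  shows "0 \<le> tensor_apply m B x $ i"
  unfolding tensor_apply_real using assms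
  by (intro sum_nonneg mult_nonneg_nonneg prod_list_map_nonneg) (auto simp: nonneg_tensor_def)

lemma tensor_apply_scaleR:
  fixes x :: "real ^ 'n::finite"
  shows "tensor_apply m B (c *\<^sub>R x) $ i = c ^ (m - 1) * tensor_apply m B x $ i"
proof -
  have "(\<Prod>j\<leftarrow>js. (c *\<^sub>R x) $ j) = c ^ length js * (\<Prod>j\<leftarrow>js. x $ j)" for js
    by (induction js) auto
  then show ?thesis
    unfolding tensor_apply_real by (auto simp: sum_distrib_left simp del: vector_scaleR_component intro!: sum.cong)
qed

lemma tensor_apply_of_real:
  fixes x :: "real ^ 'n::finite"
  shows "tensor_apply m B (\<chi> j. (of_real (x $ j) :: 'a::real_field)) $ i =
    of_real (tensor_apply m B x $ i)"
proof -
  have "(\<Prod>j\<leftarrow>js. of_real (x $ j) :: 'a) = of_real (\<Prod>j\<leftarrow>js. x $ j)" for js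
    by (induction js) auto
  then show ?thesis
    by (simp add: tensor_apply_def)
qed

lemma norm_tensor_apply_le:
  fixes x :: "complex ^ 'n::finite"
  assumes "m \<ge> 1" "nonneg_tensor m B"
  shows "cmod (tensor_apply m B x $ i) \<le> tensor_apply m B (\<chi> j. cmod (x $ j)) $ i"
proof -
  have "cmod (\<Prod>j\<leftarrow>js. x $ j) = (\<Prod>j\<leftarrow>js. cmod (x $ j))" for js
    by (induction js) (auto simp: norm_mult)
  then have "cmod (of_real (B (i # js)) * (\<Prod>j\<leftarrow>js. x $ j)) =
      B (i # js) * (\<Prod>j\<leftarrow>js. cmod (x $ j))" if "length js = m - 1" for js
    using assms that by (auto simp: norm_mult nonneg_tensor_def)
  then show ?thesis
    by (auto simp: tensor_apply_def intro!: sum_norm_le)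
qed

lemma continuous_on_tensor_apply:
  "continuous_on S (\<lambda>x :: real ^ 'n::finite. tensor_apply m B x $ i)"
proof -
  have "continuous_on S (\<lambda>x :: real ^ 'n. \<Prod>j\<leftarrow>js. x $ j)" for js
    by (induction js) (auto intro!: continuous_intros)
  then show ?thesis
    unfolding tensor_apply_real by (intro continuous_intros)
qed

lemma tensor_apply_Z_splitting:
  fixes x :: "real ^ 'n::finite"
  assumes "m \<ge> 1" "Z_splitting m A t B"
  shows "tensor_apply m A x $ i = t * x $ i ^ (m - 1) - tensor_apply m B x $ i"
proof -
  let ?L = "{js :: 'n list. length js = m - 1}"
  have fin: "finite ?L"
    using finite_lists_length_eq[of "UNIV :: 'n set" "m - 1"] by simp
  have diag: "diagonal_index m (i # js) \<longleftrightarrow> js = replicate (m - 1) i" for js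
  proof -
    have "replicate m j = j # replicate (m - 1) j" for j :: 'n
      using assms(1) by (cases m) auto
    then show ?thesis
      by (auto simp: diagonal_index_def)
  qed
  have "tensor_apply m A x $ i =
      (\<Sum>js\<in>?L. (t * identity_tensor m (i # js) - B (i # js)) * (\<Prod>j\<leftarrow>js. x $ j))"
    unfolding tensor_apply_real using assms by (intro sum.cong) (auto simp: Z_splitting_def)
  also have "\<dots> = (\<Sum>js\<in>?L. t * identity_tensor m (i # js) * (\<Prod>j\<leftarrow>js. x $ j))
      - tensor_apply m B x $ i"
    unfolding tensor_apply_real by (simp add: left_diff_distrib sum_subtractf)
  also have "(\<Sum>js\<in>?L. t * identity_tensor m (i # js) * (\<Prod>j\<leftarrow>js. x $ j)) =
      (\<Sum>js\<in>?L. if js = replicate (m - 1) i then t * x $ i ^ (m - 1) else 0)"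
    by (intro sum.cong) (auto simp: identity_tensor_def diag)
  also have "\<dots> = t * x $ i ^ (m - 1)"
    using fin by (simp add: sum.delta)
  finally show ?thesis .
qed

section \<open>Perron--Frobenius theory of nonnegative tensors\<close>

text \<open>
  The standard simplex: nonnegative vectors with coordinate sum $1$, as a set of vectors.
\<close>

definition std_simplex :: "(real ^ 'n::finite) set" where
  "std_simplex = {x. (\<forall>i. 0 \<le> x $ i) \<and> (\<Sum>i\<in>UNIV. x $ i) = 1}"

lemma compact_std_simplex: "compact (std_simplex :: (real ^ 'n::finite) set)"
proof -
  have "bounded (std_simplex :: (real ^ 'n) set)"
    unfolding bounded_iff
  proof (intro exI ballI)
    fix x :: "real ^ 'n"
    assume "x \<in> std_simplex"
    then show "norm x \<le> 1"
      using norm_le_l1_cart[of x] by (auto simp: std_simplex_def)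
  qed
  moreover have "closed (std_simplex :: (real ^ 'n) set)"
    unfolding std_simplex_def
    by (intro closed_Collect_conj closed_Collect_all closed_Collect_le closed_Collect_eq
        continuous_intros)
  ultimately show ?thesis
    by (simp add: compact_eq_bounded_closed)
qed

lemma convex_std_simplex: "convex (std_simplex :: (real ^ 'n::finite) set)"
  by (rule convexI) (auto simp: std_simplex_def sum.distrib sum_distrib_left[symmetric])

lemma std_simplex_nonempty: "(std_simplex :: (real ^ 'n::finite) set) \<noteq> {}"
proof -
  have "axis undefined 1 \<in> (std_simplex :: (real ^ 'n) set)"
    by (auto simp: std_simplex_def axis_def sum.delta)
  then show ?thesis
    by blast
qed

text \<open>
  A positive solution of the perturbed eigenvalue equation, as a fixed point of the map that
  takes $k$-th roots of $(\mathcal{B}\mathbf{x}^{k})_i + \varepsilon$ and rescales to the simplex.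
  The eigenvalue is the $k$-th power of the scaling factor, which is thus a continuous function
  of $\mathbf{x}$ and $\varepsilon$.
\<close>

lemma perturbed_eigenvector:
  fixes B :: "('n::finite) tensor"
  assumes m: "m \<ge> 2" and B: "nonneg_tensor m B" and e: "e > 0"
  obtains x where "x \<in> std_simplex"
    "\<And>i. (\<Sum>j\<in>UNIV. root (m - 1) (tensor_apply m B x $ j + e)) * x $ i =
      root (m - 1) (tensor_apply m B x $ i + e)"
    "\<And>i. 0 < x $ i"
proof -
  define g where "g x i = root (m - 1) (tensor_apply m B x $ i + e)" for x :: "real ^ 'n" and i
  define s where "s x = (\<Sum>j\<in>UNIV. g x j)" for x
  define h where "h x = (\<chi> i. g x i / s x)" for x
  have g: "0 < g x i" if "x \<in> std_simplex" for x i
  proof -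
    have "0 \<le> tensor_apply m B x $ i"
      using that m B by (intro tensor_apply_nonneg) (auto simp: std_simplex_def)
    then show ?thesis
      using m e by (simp add: g_def)
  qed
  have s: "0 < s x" if "x \<in> std_simplex" for x
    unfolding s_def using g[OF that] by (intro sum_pos) auto
  have gcont: "continuous_on std_simplex (\<lambda>x. g x i)" for i
    unfolding g_def by (intro continuous_intros continuous_on_tensor_apply)
  have "continuous_on std_simplex h"
    unfolding h_def s_def using s
    by (intro continuous_on_vec_lambda continuous_on_divide continuous_on_sum gcont)
       (force simp: s_def)
  moreover have "h \<in> std_simplex \<rightarrow> std_simplex"
  proof
    fix x :: "real ^ 'n"
    assume x: "x \<in> std_simplex"
    have "(\<Sum>i\<in>UNIV. g x i / s x) = 1"
      using s[OF x] by (simp add: s_def flip: sum_divide_distrib)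
    then show "h x \<in> std_simplex"
      using g[OF x] s[OF x] by (auto simp: std_simplex_def h_def less_imp_le)
  qed
  ultimately obtain x where x: "x \<in> std_simplex" "h x = x"
    using brouwer[OF compact_std_simplex convex_std_simplex std_simplex_nonempty] by metis
  have xi: "x $ i = g x i / s x" for i
    using arg_cong[OF x(2), of "\<lambda>v. v $ i"] by (simp add: h_def)
  show thesis
  proof
    show "x \<in> std_simplex"
      by fact
    fix i
    show "0 < x $ i"
      using xi g s x(1) by simp
    have "s x * x $ i = g x i"
      using xi[of i] s[OF x(1)] by (simp add: field_simps)
    then show "(\<Sum>j\<in>UNIV. root (m - 1) (tensor_apply m B x $ j + e)) * x $ i =
      root (m - 1) (tensor_apply m B x $ i + e)"
      by (simp add: s_def g_def)
  qed
qed

text \<open>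
  A positive vector with $\mathcal{B}\mathbf{x}^{k} \le \lambda\mathbf{x}^{[k]}$ bounds every
  Collatz--Wielandt value from above: compare $\mathbf{y}$ with the smallest multiple of
  $\mathbf{x}$ that dominates it, at an index where the two agree.
\<close>

lemma collatz_wielandt_upper_bound:
  fixes x y :: "real ^ 'n::finite"
  assumes m: "m \<ge> 1" and B: "nonneg_tensor m B"
    and x: "\<And>i. 0 < x $ i" and sup: "\<And>i. tensor_apply m B x $ i \<le> l * x $ i ^ (m - 1)"
    and y: "\<And>i. 0 \<le> y $ i" "y \<noteq> 0" and sub: "\<And>i. r * y $ i ^ (m - 1) \<le> tensor_apply m B y $ i"
  shows "r \<le> l"
proof -
  define c where "c = Max (range (\<lambda>i. y $ i / x $ i))"
  have "c \<in> range (\<lambda>i. y $ i / x $ i)"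
    unfolding c_def by (intro Max_in) auto
  then obtain i where i: "c = y $ i / x $ i"
    by blast
  have le: "y $ j / x $ j \<le> c" for j
    unfolding c_def by (intro Max_ge) auto
  have dom: "y $ j \<le> (c *\<^sub>R x) $ j" for j
    using le[of j] x[of j] by (simp add: field_simps)
  obtain j where "y $ j \<noteq> 0"
    using y(2) by (auto simp: vec_eq_iff)
  then have "0 < y $ j / x $ j"
    using y(1)[of j] x[of j] by (simp add: less_le)
  then have c: "0 < c"
    using le[of j] by simp
  have yi: "y $ i = c * x $ i"
    using i x[of i] by simp
  have "r * y $ i ^ (m - 1) \<le> tensor_apply m B (c *\<^sub>R x) $ i"
    using sub[of i] tensor_apply_mono[OF m B y(1) dom, of i] by simp
  also have "\<dots> \<le> c ^ (m - 1) * (l * x $ i ^ (m - 1))"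
    unfolding tensor_apply_scaleR using c sup by (intro mult_left_mono) auto
  also have "\<dots> = l * y $ i ^ (m - 1)"
    by (simp add: yi power_mult_distrib)
  finally show ?thesis
    using yi c x[of i] by simp
qed

text \<open>
  The eigenvalue is the limit of the perturbed eigenvalues \<open>s (X n) (e n) ^ k\<close>, each of which
  bounds all Collatz--Wielandt values because \<open>X n\<close> is positive. The limit vector itself may have
  zero entries, so that bound cannot be applied to it directly.
\<close>

theorem perron_frobenius_nonneg_tensor:
  fixes B :: "('n::finite) tensor"
  assumes m: "m \<ge> 2" and B: "nonneg_tensor m B"
  obtains \<rho> and x :: "real ^ 'n" where "0 \<le> \<rho>" "\<And>i. 0 \<le> x $ i" "x \<noteq> 0"
    "\<And>i. tensor_apply m B x $ i = \<rho> * x $ i ^ (m - 1)"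
    "\<And>r y. \<lbrakk>\<And>i. 0 \<le> y $ i; y \<noteq> 0; \<And>i. r * y $ i ^ (m - 1) \<le> tensor_apply m B y $ i\<rbrakk>
      \<Longrightarrow> r \<le> \<rho>"
proof -
  define k where "k = m - 1"
  have k: "0 < k"
    using m by (simp add: k_def)
  define e where "e n = inverse (real (Suc n))" for n
  have e: "0 < e n" for n
    by (simp add: e_def)
  have e_lim: "e \<longlonglongrightarrow> 0"
    unfolding e_def by (rule LIMSEQ_inverse_real_of_nat)
  define s where "s x d = (\<Sum>j\<in>UNIV. root k (tensor_apply m B x $ j + d))"
    for x :: "real ^ 'n" and d
  have "\<exists>x. x \<in> std_simplex \<and> (\<forall>i. s x (e n) * x $ i = root k (tensor_apply m B x $ i + e n))
      \<and> (\<forall>i. 0 < x $ i)" for n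
    using perturbed_eigenvector[OF m B e[of n]] unfolding s_def k_def by metis
  then obtain X where X: "\<And>n. X n \<in> std_simplex"
      "\<And>n i. s (X n) (e n) * X n $ i = root k (tensor_apply m B (X n) $ i + e n)"
      "\<And>n i. 0 < X n $ i"
    by metis
  obtain x \<phi> where x: "x \<in> std_simplex" and \<phi>: "strict_mono \<phi>" and "(X \<circ> \<phi>) \<longlonglongrightarrow> x"
    using compact_std_simplex X(1) unfolding compact_def by metis
  then have lim: "(\<lambda>n. X (\<phi> n)) \<longlonglongrightarrow> x"
    by (simp add: o_def)
  have F_lim: "(\<lambda>n. tensor_apply m B (X (\<phi> n)) $ i) \<longlonglongrightarrow> tensor_apply m B x $ i" for i
    using continuous_on_tendsto_compose[OF continuous_on_tensor_apply[of UNIV] lim] by simp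
  have e_sub: "(\<lambda>n. e (\<phi> n)) \<longlonglongrightarrow> 0"
    using LIMSEQ_subseq_LIMSEQ[OF e_lim \<phi>] by (simp add: o_def)
  have g_lim: "(\<lambda>n. root k (tensor_apply m B (X (\<phi> n)) $ i + e (\<phi> n)))
      \<longlonglongrightarrow> root k (tensor_apply m B x $ i)" for i
    using tendsto_add[OF F_lim e_sub] by (intro tendsto_real_root) simp
  have s_lim: "(\<lambda>n. s (X (\<phi> n)) (e (\<phi> n))) \<longlonglongrightarrow> s x 0"
    unfolding s_def by (simp add: g_lim tendsto_sum)
  have eig: "s x 0 * x $ i = root k (tensor_apply m B x $ i)" for i
  proof (rule LIMSEQ_unique)
    show "(\<lambda>n. s (X (\<phi> n)) (e (\<phi> n)) * X (\<phi> n) $ i) \<longlonglongrightarrow> s x 0 * x $ i"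
      by (intro tendsto_mult s_lim tendsto_vec_nth lim)
    show "(\<lambda>n. s (X (\<phi> n)) (e (\<phi> n)) * X (\<phi> n) $ i) \<longlonglongrightarrow> root k (tensor_apply m B x $ i)"
      unfolding X(2) by (rule g_lim)
  qed
  have F_nonneg: "0 \<le> tensor_apply m B v $ i" if "v \<in> std_simplex" for v i
    using that m B by (intro tensor_apply_nonneg) (auto simp: std_simplex_def)
  show thesis
  proof
    show "0 \<le> s x 0 ^ k"
      using F_nonneg[OF x] k by (auto simp: s_def intro!: zero_le_power sum_nonneg)
    show "0 \<le> x $ i" for i
      using x by (simp add: std_simplex_def)
    show "x \<noteq> 0"
      using x by (auto simp: std_simplex_def)
    show "tensor_apply m B x $ i = s x 0 ^ k * x $ i ^ (m - 1)" for i
    proof -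
      have "s x 0 ^ k * x $ i ^ (m - 1) = root k (tensor_apply m B x $ i) ^ k"
        by (simp only: eig k_def[symmetric] power_mult_distrib[symmetric])
      also have "\<dots> = tensor_apply m B x $ i"
        using k F_nonneg[OF x] by simp
      finally show ?thesis
        by simp
    qed
    show "r \<le> s x 0 ^ k"
      if y: "\<And>i. 0 \<le> y $ i" "y \<noteq> 0"
        and r: "\<And>i. r * y $ i ^ (m - 1) \<le> tensor_apply m B y $ i" for r y
    proof -
      have "r \<le> s (X n) (e n) ^ k" for n
      proof (rule collatz_wielandt_upper_bound)
        show "tensor_apply m B (X n) $ i \<le> s (X n) (e n) ^ k * X n $ i ^ (m - 1)" for i
        proof -
          have "s (X n) (e n) ^ k * X n $ i ^ (m - 1) =
              root k (tensor_apply m B (X n) $ i + e n) ^ k"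
            by (simp only: X(2) k_def[symmetric] power_mult_distrib[symmetric])
          also have "\<dots> = tensor_apply m B (X n) $ i + e n"
            using k F_nonneg[OF X(1)] e[of n] by (simp add: add_nonneg_nonneg)
          finally show ?thesis
            using e[of n] by simp
        qed
      qed (use m B X y r in auto)
      then show ?thesis
        using LIMSEQ_le_const[OF tendsto_power[OF s_lim]] by blast
    qed
  qed
qed

corollary spectral_radius_nonneg_tensor:
  fixes B :: "('n::finite) tensor"
  assumes m: "m \<ge> 2" and B: "nonneg_tensor m B"
  obtains x :: "real ^ 'n" where "\<And>i. 0 \<le> x $ i" "x \<noteq> 0"
    "\<And>i. tensor_apply m B x $ i = tensor_spectral_radius m B * x $ i ^ (m - 1)"
    "\<And>r y. \<lbrakk>\<And>i. 0 \<le> y $ i; y \<noteq> 0; \<And>i. r * y $ i ^ (m - 1) \<le> tensor_apply m B y $ i\<rbrakk>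
      \<Longrightarrow> r \<le> tensor_spectral_radius m B"
proof -
  obtain \<rho> and x :: "real ^ 'n" where \<rho>: "0 \<le> \<rho>" and x: "\<And>i. 0 \<le> x $ i" "x \<noteq> 0"
    and eig: "\<And>i. tensor_apply m B x $ i = \<rho> * x $ i ^ (m - 1)"
    and max: "\<And>r y. \<lbrakk>\<And>i. 0 \<le> y $ i; y \<noteq> 0;
      \<And>i. r * y $ i ^ (m - 1) \<le> tensor_apply m B y $ i\<rbrakk> \<Longrightarrow> r \<le> \<rho>"
    by (rule perron_frobenius_nonneg_tensor[OF m B]) blast
  have "tensor_spectral_radius m B = \<rho>"
    unfolding tensor_spectral_radius_def
  proof (rule Greatest_equality)
    have "tensor_eigenvalue m B (of_real \<rho>)"
      unfolding tensor_eigenvalue_def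
    proof (intro exI conjI)
      show "(\<chi> i. (of_real (x $ i) :: complex)) \<noteq> 0"
        using x(2) by (simp add: vec_eq_iff)
      show "tensor_apply m B (\<chi> i. (of_real (x $ i) :: complex)) =
          (\<chi> i. of_real \<rho> * (\<chi> i. of_real (x $ i)) $ i ^ (m - 1))"
        by (simp add: vec_eq_iff tensor_apply_of_real eig)
    qed
    then show "\<exists>\<mu>. tensor_eigenvalue m B \<mu> \<and> \<rho> = cmod \<mu>"
      using \<rho> by (intro exI[of _ "of_real \<rho>"]) simp
    fix r
    assume "\<exists>\<mu>. tensor_eigenvalue m B \<mu> \<and> r = cmod \<mu>"
    then obtain \<mu> and z :: "complex ^ 'n" where r: "r = cmod \<mu>" and z: "z \<noteq> 0"
      and zeig: "tensor_apply m B z = (\<chi> i. \<mu> * (z $ i) ^ (m - 1))"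
      unfolding tensor_eigenvalue_def by blast
    show "r \<le> \<rho>"
    proof (rule max)
      show "(\<chi> j. cmod (z $ j)) \<noteq> 0"
        using z by (simp add: vec_eq_iff)
      show "r * (\<chi> j. cmod (z $ j)) $ i ^ (m - 1) \<le> tensor_apply m B (\<chi> j. cmod (z $ j)) $ i" for i
        using norm_tensor_apply_le[OF _ B, of z i] m
        by (simp add: zeig r norm_mult norm_power)
    qed simp
  qed
  then show thesis
    using that x eig max by blast
qed

section \<open>Semi-positivity and M-tensors\<close>

lemma Z_tensor_splitting:
  fixes A :: "('n::finite) tensor"
  assumes "Z_tensor m A"
  obtains t B where "Z_splitting m A t B"
proof -
  \<comment> \<open>any upper bound of the diagonal entries would do\<close>
  define t where "t = (\<Sum>i\<in>UNIV. \<bar>A (replicate m i)\<bar>)"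
  have diag: "A (replicate m i) \<le> t" for i
  proof -
    have "\<bar>A (replicate m i)\<bar> \<le> t"
      unfolding t_def by (intro member_le_sum) auto
    then show ?thesis
      by simp
  qed
  have "Z_splitting m A t (\<lambda>js. t * identity_tensor m js - A js)"
    using assms diag
    by (auto simp: Z_splitting_def nonneg_tensor_def Z_tensor_def identity_tensor_def
        diagonal_index_def)
  then show thesis
    by (rule that)
qed

lemma semi_positive_iff_spectral_radius_le:
  fixes A B :: "('n::finite) tensor"
  assumes m: "m \<ge> 2" and split: "Z_splitting m A t B"
  shows "semi_positive m A \<longleftrightarrow> tensor_spectral_radius m B \<le> t"
proof -
  let ?\<rho> = "tensor_spectral_radius m B"
  have B: "nonneg_tensor m B"
    using split by (simp add: Z_splitting_def)
  have A: "tensor_apply m A x $ i = t * x $ i ^ (m - 1) - tensor_apply m B x $ i"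
    for x :: "real ^ 'n" and i
    using m by (intro tensor_apply_Z_splitting[OF _ split]) simp
  obtain x :: "real ^ 'n" where x: "\<And>i. 0 \<le> x $ i" "x \<noteq> 0"
    and eig: "\<And>i. tensor_apply m B x $ i = ?\<rho> * x $ i ^ (m - 1)"
    and max: "\<And>r y. \<lbrakk>\<And>i. 0 \<le> y $ i; y \<noteq> 0;
      \<And>i. r * y $ i ^ (m - 1) \<le> tensor_apply m B y $ i\<rbrakk> \<Longrightarrow> r \<le> ?\<rho>"
    by (rule spectral_radius_nonneg_tensor[OF m B]) blast
  show ?thesis
  proof
    assume "semi_positive m A"
    then obtain i where i: "0 < x $ i" "0 \<le> tensor_apply m A x $ i"
      using x unfolding semi_positive_def by blast
    then show "?\<rho> \<le> t"
      by (simp add: A eig)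
  next
    assume le: "?\<rho> \<le> t"
    show "semi_positive m A"
      unfolding semi_positive_def
    proof (rule ccontr)
      assume "\<not> (\<forall>y :: real ^ 'n. (\<forall>i. 0 \<le> y $ i) \<and> y \<noteq> 0 \<longrightarrow>
        (\<exists>i. 0 < y $ i \<and> 0 \<le> tensor_apply m A y $ i))"
      then obtain y :: "real ^ 'n" where y: "\<And>i. 0 \<le> y $ i" "y \<noteq> 0"
        and neg: "\<And>i. 0 < y $ i \<Longrightarrow> t * y $ i ^ (m - 1) < tensor_apply m B y $ i"
        by (auto simp: A not_le)
      let ?S = "{i. 0 < y $ i}"
      define q where "q i = tensor_apply m B y $ i / y $ i ^ (m - 1)" for i
      \<comment> \<open>the largest Collatz--Wielandt value of \<open>y\<close>, attained on the support, hence above \<open>t\<close>\<close>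
      define t' where "t' = Min (q ` ?S)"
      obtain j where "y $ j \<noteq> 0"
        using y(2) by (auto simp: vec_eq_iff)
      then have S: "?S \<noteq> {}"
        using y(1)[of j] by (auto simp: less_le)
      have "t < q i" if "i \<in> ?S" for i
        using neg[of i] that by (simp add: q_def field_simps)
      then have t': "t < t'"
        unfolding t'_def using S by simp
      have "t' \<le> ?\<rho>"
      proof (rule max[OF y])
        fix i
        show "t' * y $ i ^ (m - 1) \<le> tensor_apply m B y $ i"
        proof (cases "0 < y $ i")
          case True
          then have "t' \<le> q i"
            unfolding t'_def by (intro Min_le) auto
          then show ?thesis
            using True by (simp add: q_def field_simps)
        next
          case False
          then have "y $ i = 0"
            using y(1)[of i] by simp
          then show ?thesis
            using m tensor_apply_nonneg[OF _ B y(1), of i] by (simp add: power_0_left)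
        qed
      qed
      then show False
        using t' le by simp
    qed
  qed
qed

lemma strictly_semi_positive_iff_spectral_radius_less:
  fixes A B :: "('n::finite) tensor"
  assumes m: "m \<ge> 2" and split: "Z_splitting m A t B"
  shows "strictly_semi_positive m A \<longleftrightarrow> tensor_spectral_radius m B < t"
proof -
  let ?\<rho> = "tensor_spectral_radius m B"
  have B: "nonneg_tensor m B"
    using split by (simp add: Z_splitting_def)
  have A: "tensor_apply m A x $ i = t * x $ i ^ (m - 1) - tensor_apply m B x $ i"
    for x :: "real ^ 'n" and i
    using m by (intro tensor_apply_Z_splitting[OF _ split]) simp
  obtain x :: "real ^ 'n" where x: "\<And>i. 0 \<le> x $ i" "x \<noteq> 0"
    and eig: "\<And>i. tensor_apply m B x $ i = ?\<rho> * x $ i ^ (m - 1)"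
    and max: "\<And>r y. \<lbrakk>\<And>i. 0 \<le> y $ i; y \<noteq> 0;
      \<And>i. r * y $ i ^ (m - 1) \<le> tensor_apply m B y $ i\<rbrakk> \<Longrightarrow> r \<le> ?\<rho>"
    by (rule spectral_radius_nonneg_tensor[OF m B]) blast
  show ?thesis
  proof
    assume "strictly_semi_positive m A"
    then obtain i where i: "0 < x $ i" "0 < tensor_apply m A x $ i"
      using x unfolding strictly_semi_positive_def by blast
    then show "?\<rho> < t"
      by (simp add: A eig)
  next
    assume less: "?\<rho> < t"
    show "strictly_semi_positive m A"
      unfolding strictly_semi_positive_def
    proof (rule ccontr)
      assume "\<not> (\<forall>y :: real ^ 'n. (\<forall>i. 0 \<le> y $ i) \<and> y \<noteq> 0 \<longrightarrow>
        (\<exists>i. 0 < y $ i \<and> 0 < tensor_apply m A y $ i))"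
      then obtain y :: "real ^ 'n" where y: "\<And>i. 0 \<le> y $ i" "y \<noteq> 0"
        and nonpos: "\<And>i. 0 < y $ i \<Longrightarrow> t * y $ i ^ (m - 1) \<le> tensor_apply m B y $ i"
        unfolding A by (metis diff_gt_0_iff_gt not_less)
      have "t \<le> ?\<rho>"
      proof (rule max[OF y])
        fix i
        show "t * y $ i ^ (m - 1) \<le> tensor_apply m B y $ i"
        proof (cases "0 < y $ i")
          case False
          then have "y $ i = 0"
            using y(1)[of i] by simp
          then show ?thesis
            using m tensor_apply_nonneg[OF _ B y(1), of i] by (simp add: power_0_left)
        qed (rule nonpos)
      qed
      then show False
        using less by simp
    qed
  qed
qed

theorem theorem4:
  fixes A :: "('n::finite) tensor" and m :: nat
  assumes "m \<ge> 2" and "Z_tensor m A"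
  shows "(semi_positive m A \<longleftrightarrow> M_tensor m A) \<and>
         (strictly_semi_positive m A \<longleftrightarrow> strong_M_tensor m A)"
proof -
  obtain t B where "Z_splitting m A t B"
    using Z_tensor_splitting[OF assms(2)] by blast
  then show ?thesis
    unfolding M_tensor_def strong_M_tensor_def
    using assms semi_positive_iff_spectral_radius_le[OF assms(1)]
      strictly_semi_positive_iff_spectral_radius_less[OF assms(1)]
    by blast
qed

end
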